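(* Let $k$ be an uncountable algebraically closed field, let $S=k[z_1,z_2,\dots]$ be the polynomial ring over $k$ in countably infinitely many variables indexed by $\mathbb{N}=\{1,2,\dots\}$, and let $\mathfrak{M}$ be a maximal ideal of $S$. Then $V(\mathfrak{M})\neq\emptyset$.
   Context: For an ideal $\mathfrak{J}$ of $S$, $V(\mathfrak{J})=\{a=(a_i)_{i\in\mathbb{N}}\in k^{\mathbb{N}}: f(a)=0\text{ for all }f\in\mathfrak{J}\}$. *)

theory Defs
  imports
    "HOL-Library.Poly_Mapping"
    "HOL-Library.Countable_Set"
    "HOL-Algebra.Algebraic_Closure_Type"
begin

text \<open>
  The polynomial ring \<open>k[z\<^sub>1, z\<^sub>2, \<dots>]\<close> is the monoid algebra over \<open>k\<close> of the monomials, i.e. of the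
  finitely supported exponent functions; its ring structure is the convolution structure of
  \<^theory>\<open>HOL-Library.Poly_Mapping\<close>.  The variables are numbered from \<open>0\<close>: the index \<open>i :: nat\<close>
  stands for \<open>z\<^sub>i\<^sub>+\<^sub>1\<close>, and likewise for the coordinates of points.
\<close>

type_synonym 'k inf_mpoly = "(nat \<Rightarrow>\<^sub>0 nat) \<Rightarrow>\<^sub>0 'k"

definition eval_monom :: "(nat \<Rightarrow> 'k::comm_semiring_1) \<Rightarrow> (nat \<Rightarrow>\<^sub>0 nat) \<Rightarrow> 'k"
  where "eval_monom a m = (\<Prod>i\<in>Poly_Mapping.keys m. a i ^ Poly_Mapping.lookup m i)"

definition eval_inf_mpoly :: "(nat \<Rightarrow> 'k::comm_semiring_1) \<Rightarrow> 'k inf_mpoly \<Rightarrow> 'k"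
  where "eval_inf_mpoly a f = (\<Sum>m\<in>Poly_Mapping.keys f. Poly_Mapping.lookup f m * eval_monom a m)"

definition zero_locus :: "'k::comm_semiring_1 inf_mpoly set \<Rightarrow> (nat \<Rightarrow> 'k) set"
  where "zero_locus J = {a. \<forall>f\<in>J. eval_inf_mpoly a f = 0}"

end

theory Submission
  imports Defs
begin

text \<open>
  Let \<open>z\<close> be a variable and suppose that \<open>z - c\<close> is a unit modulo \<open>\<MM>\<close>, with inverse \<open>u\<^sub>c\<close>, for every
  \<open>c \<in> k\<close>.  Since \<open>S\<close> has countable dimension and \<open>k\<close> is uncountable, infinitely many of the \<open>u\<^sub>c\<close> lie
  in one finite-dimensional subspace, so they satisfy a nontrivial linear relation; clearing
  denominators gives a nonzero polynomial \<open>p\<close> in one variable with \<open>p(z) \<in> \<MM>\<close>.  As \<open>p\<close> splits into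
  linear factors and \<open>\<MM>\<close> is prime, \<open>z - c \<in> \<MM>\<close> for some \<open>c\<close> after all.  These values \<open>c\<close>, one for
  each variable, are the coordinates of a point of \<open>V(\<MM>)\<close>.
\<close>

section \<open>Maximal ideals of a commutative ring: primality, inverses, congruences\<close>

context
  fixes M :: "'a::comm_ring_1 set"
  assumes max: "maximalideal M (ring_of_type_algebra :: 'a ring)"
begin

lemma maximal_zero: "0 \<in> M"
  using additive_subgroup.zero_closed[OF ideal.axioms(1)[OF maximalideal.axioms(1)[OF max]]]
  by (simp add: ring_of_type_algebra_def)

lemma maximal_add: "x \<in> M \<Longrightarrow> y \<in> M \<Longrightarrow> x + y \<in> M"
  using additive_subgroup.a_closed[OF ideal.axioms(1)[OF maximalideal.axioms(1)[OF max]]]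
  by (simp add: ring_of_type_algebra_def)

lemma maximal_mult: "x \<in> M \<Longrightarrow> y * x \<in> M"
  using ideal.I_l_closed[OF maximalideal.axioms(1)[OF max]]
  by (simp add: ring_of_type_algebra_def)

lemma maximal_diff: "x \<in> M \<Longrightarrow> y \<in> M \<Longrightarrow> x - y \<in> M"
  using maximal_add[of x "- 1 * y"] maximal_mult[of y "-1"] by simp

lemma maximal_sum: "(\<And>i. i \<in> I \<Longrightarrow> f i \<in> M) \<Longrightarrow> sum f I \<in> M"
  by (induction I rule: infinite_finite_induct) (auto intro: maximal_zero maximal_add)

lemma maximal_one: "1 \<notin> M"
proof
  assume "1 \<in> M"
  then have "M = UNIV"
    using maximal_mult[of 1] by auto
  then show False
    using maximalideal.I_notcarr[OF max] by (simp add: ring_of_type_algebra_def)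
qed

lemma maximal_prime: "x * y \<in> M \<Longrightarrow> x \<in> M \<or> y \<in> M"
  using primeideal.I_prime[OF cring.maximalideal_prime[OF cring_from_type_algebra max]]
  by (simp add: ring_of_type_algebra_def)

lemma maximal_prod_mset: "prod_mset A \<in> M \<Longrightarrow> \<exists>x\<in>#A. x \<in> M"
  by (induction A) (use maximal_one maximal_prime in auto)

text \<open>The ideal \<open>J\<close> generated by \<open>M\<close> and \<open>x\<close> is
  strictly larger than \<open>M\<close>, hence the whole ring by maximality; writing
  \<open>1\<close> as an element of \<open>J\<close> yields \<open>u\<close>.\<close>

lemma maximal_inverse:
  assumes "x \<notin> M"
  shows "\<exists>u. x * u - 1 \<in> M"
proof -
  define J where "J = {x * u + m | u m. m \<in> M}"
  have sub: "M \<subseteq> J"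
    by (force simp: J_def intro: exI[of _ 0])
  have J_add: "a + b \<in> J" if "a \<in> J" "b \<in> J" for a b
  proof -
    from that obtain u m v n where "a = x * u + m" "b = x * v + n" "m \<in> M" "n \<in> M"
      by (auto simp: J_def)
    then have "a + b = x * (u + v) + (m + n)" "m + n \<in> M"
      by (auto simp: algebra_simps intro: maximal_add)
    then show ?thesis
      unfolding J_def by blast
  qed
  have J_mult: "b * a \<in> J" if "a \<in> J" for a b
  proof -
    from that obtain u m where "a = x * u + m" "m \<in> M"
      by (auto simp: J_def)
    then have "b * a = x * (b * u) + b * m" "b * m \<in> M"
      by (auto simp: algebra_simps intro: maximal_mult)
    then show ?thesis
      unfolding J_def by blast
  qed
  have J_minus: "- a \<in> J" if "a \<in> J" for a
    using J_mult[OF that, of "-1"] by simp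
  interpret R: cring "ring_of_type_algebra :: 'a ring"
    by (rule cring_from_type_algebra)
  have "ideal J (ring_of_type_algebra :: 'a ring)"
  proof (rule idealI[OF R.ring_axioms])
    have inv: "\<ominus>\<^bsub>ring_of_type_algebra\<^esub> a = - a" for a :: 'a
      using R.minus_equality[of "- a" a] by (simp add: ring_of_type_algebra_def)
    show "subgroup J (add_monoid (ring_of_type_algebra :: 'a ring))"
    proof (rule R.add.subgroupI)
      show "J \<noteq> {}"
        using sub maximal_zero by auto
    qed (use inv J_add J_minus in \<open>simp_all add: ring_of_type_algebra_def\<close>)
  qed (use J_mult in \<open>auto simp: ring_of_type_algebra_def mult.commute\<close>)
  then have "J = M \<or> J = UNIV"
    using maximalideal.I_maximal[OF max] sub by (simp add: ring_of_type_algebra_def)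
  \<comment> \<open>This is \<open>x\<close> itself, in the shape that the definition of
    \<open>J\<close> demands; it rules out \<open>J = M\<close>.\<close>
  moreover have "x * 1 + 0 \<in> J"
    using maximal_zero unfolding J_def by blast
  ultimately have "1 \<in> J"
    using assms by auto
  then obtain u m where "1 = x * u + m" "m \<in> M"
    by (auto simp: J_def)
  then have "x * u - 1 = - 1 * m"
    by (simp add: algebra_simps)
  then show ?thesis
    using maximal_mult[OF \<open>m \<in> M\<close>, of "-1"] by metis
qed

text \<open>Together with the versions for powers and finite products, this lifts congruences
  between variables and constants to monomials.\<close>

lemma maximal_cong_mult:
  assumes "x - x' \<in> M" "y - y' \<in> M"
  shows "x * y - x' * y' \<in> M"
proof -
  have "x * y - x' * y' = y * (x - x') + x' * (y - y')"
    by (simp add: algebra_simps)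
  then show ?thesis
    using assms by (simp add: maximal_add maximal_mult)
qed

lemma maximal_cong_power: "x - y \<in> M \<Longrightarrow> x ^ n - y ^ n \<in> M"
  by (induction n) (auto intro: maximal_zero maximal_cong_mult)

lemma maximal_cong_prod: "(\<And>i. i \<in> I \<Longrightarrow> f i - g i \<in> M) \<Longrightarrow> prod f I - prod g I \<in> M"
  by (induction I rule: infinite_finite_induct) (auto intro: maximal_zero maximal_cong_mult)

end

section \<open>Algebras over a field, with structure map \<open>C\<close>\<close>

context
  fixes C :: "'k::field \<Rightarrow> 'a::comm_ring_1"
  assumes C_add: "C (x + y) = C x + C y"
    and C_mult: "C (x * y) = C x * C y"
    and C_one: "C 1 = 1"
begin

lemma hom_zero: "C 0 = 0"
  using C_add[of 0 0] by simp

lemma hom_diff: "C (x - y) = C x - C y"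
  using C_add[of "x - y" y] by (simp add: algebra_simps)

lemma hom_minus: "C (- x) = - C x"
  using hom_diff[of 0 x] by (simp add: hom_zero)

text \<open>Gives access to span and linear dependence over \<open>k\<close> in an algebra known
  only through its structure map.\<close>

lemma vector_space_hom: "vector_space (\<lambda>a x. C a * x)"
  by unfold_locales (auto simp: algebra_simps C_add C_mult C_one)

lemma hom_notin_maximal:
  assumes "maximalideal M (ring_of_type_algebra :: 'a ring)" "c \<noteq> 0"
  shows "C c \<notin> M"
proof
  assume "C c \<in> M"
  then have "C (inverse c) * C c \<in> M"
    by (rule maximal_mult[OF assms(1)])
  then show False
    using assms(2) maximal_one[OF assms(1)] by (simp flip: C_mult add: C_one)
qed

text \<open>Horner recursion for the substitution of \<open>z\<close> into a polynomial over
  \<open>k\<close>. The inductions below use it to show that this substitution is a ring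
  homomorphism.\<close>

lemma poly_map_pCons: "poly (map_poly C (pCons a p)) z = C a + z * poly (map_poly C p) z"
  by (simp add: map_poly_pCons hom_zero)

lemma poly_map_add:
  "poly (map_poly C (p + q)) z = poly (map_poly C p) z + poly (map_poly C q) z"
  by (induction p q rule: poly_induct2) (auto simp: poly_map_pCons C_add algebra_simps)

lemma poly_map_smult: "poly (map_poly C (smult a p)) z = C a * poly (map_poly C p) z"
  by (induction p) (auto simp: poly_map_pCons C_mult algebra_simps)

lemma poly_map_mult:
  "poly (map_poly C (p * q)) z = poly (map_poly C p) z * poly (map_poly C q) z"
  by (induction p)
    (auto simp: poly_map_pCons poly_map_smult poly_map_add hom_zero algebra_simps)

lemma poly_map_linear: "poly (map_poly C [:- r, 1:]) z = z - C r"
  by (simp only: poly_map_pCons) (simp add: C_one hom_minus)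

lemma poly_map_one: "poly (map_poly C 1) z = 1"
  by (simp only: one_pCons poly_map_pCons) (simp add: C_one)

lemma poly_map_sum: "poly (map_poly C (sum f I)) z = (\<Sum>i\<in>I. poly (map_poly C (f i)) z)"
  by (induction I rule: infinite_finite_induct) (auto simp: poly_map_add)

lemma poly_map_prod: "poly (map_poly C (prod f I)) z = (\<Prod>i\<in>I. poly (map_poly C (f i)) z)"
  by (induction I rule: infinite_finite_induct) (auto simp: poly_map_mult poly_map_one)

lemma poly_map_prod_mset:
  "poly (map_poly C (\<Prod>x\<in>#A. f x)) z = (\<Prod>x\<in>#A. poly (map_poly C (f x)) z)"
  by (induction A) (auto simp: poly_map_mult poly_map_one)

lemma exists_poly_in_maximal:
  assumes M: "maximalideal M (ring_of_type_algebra :: 'a ring)"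
    and unc: "uncountable (UNIV :: 'k set)"
    and B: "countable B" "module.span (\<lambda>a x. C a * x) B = UNIV"
    and notin: "\<And>c. z - C c \<notin> M"
  shows "\<exists>p. p \<noteq> 0 \<and> poly (map_poly C p) z \<in> M"
proof -
  interpret V: vector_space "\<lambda>a x. C a * x"
    by (rule vector_space_hom)
  have "\<exists>u. (z - C c) * u - 1 \<in> M" for c
    using notin by (intro maximal_inverse[OF M])
  then obtain u where u: "\<And>c. (z - C c) * u c - 1 \<in> M"
    by metis
  \<comment> \<open>A common inverse \<open>u c\<close> of \<open>z - C c\<close> and
    \<open>z - C d\<close> is killed modulo \<open>M\<close> by the nonzero constant
    \<open>C (d - c)\<close>, so it lies in \<open>M\<close>, which an inverse cannot.\<close>
  have inj: "inj u"
  proof (rule injI, rule ccontr)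
    fix c d assume eq: "u c = u d" and "c \<noteq> d"
    have "((z - C c) * u c - 1) - ((z - C d) * u d - 1) = C (d - c) * u c"
      by (simp add: hom_diff eq algebra_simps)
    then have "C (d - c) * u c \<in> M"
      using maximal_diff[OF M u u] by metis
    then have "u c \<in> M"
      using maximal_prime[OF M] hom_notin_maximal[OF M, of "d - c"] \<open>c \<noteq> d\<close> by auto
    then have "(z - C c) * u c - ((z - C c) * u c - 1) \<in> M"
      by (intro maximal_diff[OF M] u maximal_mult[OF M])
    then show False
      using maximal_one[OF M] by simp
  qed
  have "\<exists>F. finite F \<and> F \<subseteq> B \<and> u c \<in> V.span F" for c
  proof -
    have "u c \<in> V.span B"
      using B(2) by simp
    then obtain t r where t: "finite t" "t \<subseteq> B" "u c = (\<Sum>a\<in>t. C (r a) * a)"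
      unfolding V.span_explicit by blast
    have "u c \<in> V.span t"
      unfolding t(3) by (intro V.span_sum V.span_scale V.span_base)
    then show ?thesis
      using \<open>finite t\<close> \<open>t \<subseteq> B\<close> by blast
  qed
  then obtain F where F: "\<And>c. finite (F c)" "\<And>c. F c \<subseteq> B" "\<And>c. u c \<in> V.span (F c)"
    by metis
  \<comment> \<open>Pigeonhole: a countable set has only countably many finite subsets, so some
    fibre of \<open>F\<close> is uncountable.\<close>
  have "range F \<subseteq> {A. finite A \<and> A \<subseteq> B}"
    using F by auto
  then have "countable (range F)"
    using countable_Collect_finite_subset[OF B(1)] countable_subset by blast
  moreover have "UNIV = (\<Union>G\<in>range F. F -` {G})"
    by auto
  ultimately obtain G where G: "G \<in> range F" "uncountable (F -` {G})"
    using unc countable_UN[of "range F" "\<lambda>G. F -` {G}"] by metis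
  define S where "S = u ` (F -` {G})"
  have "infinite S"
    unfolding S_def using G(2) countable_finite finite_imageD inj inj_on_subset subset_UNIV by metis
  moreover have "S \<subseteq> V.span G"
    using F(3) by (force simp: S_def)
  moreover have "finite G"
    using F(1) G(1) by auto
  ultimately have "V.dependent S"
    using V.independent_span_bound by blast
  then obtain t r v where t: "finite t" "t \<subseteq> S" "(\<Sum>v\<in>t. C (r v) * v) = 0" "v \<in> t" "r v \<noteq> 0"
    unfolding V.dependent_explicit by blast
  \<comment> \<open>By injectivity of \<open>u\<close>, the relation among the vectors in
    \<open>t\<close> can be indexed by the scalars \<open>c\<close> in \<open>T\<close>.\<close>
  define T where "T = u -` t"
  define a where "a = r \<circ> u"
  have t_eq: "t = u ` T"
    using t(2) by (auto simp: S_def T_def)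
  have "finite T"
    unfolding T_def using t(1) inj by (intro finite_vimageI)
  have rel: "(\<Sum>c\<in>T. C (a c) * u c) = 0"
    using t(3) unfolding t_eq a_def by (subst (asm) sum.reindex) (auto intro: inj_on_subset[OF inj])
  obtain c0 where c0: "c0 \<in> T" "a c0 \<noteq> 0"
    using t(4,5) by (auto simp: t_eq a_def)
  \<comment> \<open>The numerator of the sum of the fractions \<open>a c / (X - c)\<close> over
    their common denominator. At \<open>c0\<close> every summand but its own contains the factor
    \<open>c0 - c0\<close>, so \<open>p\<close> does not vanish there.\<close>
  define p where "p = (\<Sum>c\<in>T. smult (a c) (\<Prod>d\<in>T - {c}. [:- d, 1:]))"
  have "poly p c0 = (\<Sum>c\<in>T. a c * (\<Prod>d\<in>T - {c}. c0 - d))"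
    by (simp add: p_def poly_sum poly_prod)
  also have "\<dots> = (\<Sum>c\<in>{c0}. a c * (\<Prod>d\<in>T - {c}. c0 - d))"
    using \<open>finite T\<close> c0 by (intro sum.mono_neutral_right) auto
  finally have "poly p c0 \<noteq> 0"
    using \<open>finite T\<close> c0 by simp
  then have "p \<noteq> 0"
    by auto
  define P where "P c = (\<Prod>d\<in>T - {c}. z - C d)" for c
  \<comment> \<open>Since \<open>(z - C c) * P c\<close> is the same full product for every
    \<open>c\<close> in \<open>T\<close>, it factors out of the terms with \<open>u c\<close>; these
    cancel by \<open>rel\<close>, and minus the value of \<open>p\<close> at \<open>z\<close>
    remains.\<close>
  have "(\<Sum>c\<in>T. C (a c) * P c * ((z - C c) * u c - 1)) \<in> M"
    by (intro maximal_sum[OF M] maximal_mult[OF M] u)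
  also have "(\<Sum>c\<in>T. C (a c) * P c * ((z - C c) * u c - 1))
      = (\<Sum>c\<in>T. (\<Prod>d\<in>T. z - C d) * (C (a c) * u c)) - (\<Sum>c\<in>T. C (a c) * P c)"
    unfolding sum_subtractf[symmetric]
  proof (intro sum.cong refl)
    fix c assume "c \<in> T"
    then have W: "(\<Prod>d\<in>T. z - C d) = (z - C c) * P c"
      unfolding P_def using \<open>finite T\<close> by (rule prod.remove[rotated])
    show "C (a c) * P c * ((z - C c) * u c - 1)
        = (\<Prod>d\<in>T. z - C d) * (C (a c) * u c) - C (a c) * P c"
      unfolding W by (simp add: algebra_simps)
  qed
  also have "\<dots> = - (\<Sum>c\<in>T. C (a c) * P c)"
    by (simp add: rel flip: sum_distrib_left)
  also have "(\<Sum>c\<in>T. C (a c) * P c) = poly (map_poly C p) z"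
    by (simp only: p_def P_def poly_map_sum poly_map_smult poly_map_prod poly_map_linear)
  finally have "- poly (map_poly C p) z \<in> M" .
  then have "poly (map_poly C p) z \<in> M"
    using maximal_mult[OF M, of "- poly (map_poly C p) z" "-1"] by simp
  then show ?thesis
    using \<open>p \<noteq> 0\<close> by blast
qed

end

text \<open>The residue field is \<open>k\<close> itself: a polynomial that vanishes at
  \<open>z\<close> modulo \<open>M\<close> splits into linear factors, and primality puts one of
  them in \<open>M\<close>.\<close>

lemma residue_of_countable_dim:
  fixes C :: "'k::alg_closed_field \<Rightarrow> 'a::comm_ring_1"
  assumes hom: "\<And>x y. C (x + y) = C x + C y" "\<And>x y. C (x * y) = C x * C y" "C 1 = 1"
    and M: "maximalideal M (ring_of_type_algebra :: 'a ring)"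
    and unc: "uncountable (UNIV :: 'k set)"
    and B: "countable B" "module.span (\<lambda>a x. C a * x) B = UNIV"
  shows "\<exists>c. z - C c \<in> M"
proof (rule ccontr)
  assume neg: "\<nexists>c. z - C c \<in> M"
  then obtain p where p: "p \<noteq> 0" "poly (map_poly C p) z \<in> M"
    using exists_poly_in_maximal[OF hom M unc B] by blast
  obtain A where A: "p = smult (lead_coeff p) (\<Prod>x\<in>#A. [:- x, 1:])"
    using alg_closed_imp_factorization[OF p(1)] by blast
  have "poly (map_poly C p) z = C (lead_coeff p) * (\<Prod>x\<in>#A. z - C x)"
    by (subst A) (simp only: poly_map_smult[OF hom] poly_map_prod_mset[OF hom] poly_map_linear[OF hom])
  then have "(\<Prod>x\<in>#A. z - C x) \<in> M"
    using p maximal_prime[OF M] hom_notin_maximal[OF hom M, of "lead_coeff p"] by auto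
  then show False
    using maximal_prod_mset[OF M] neg by fastforce
qed

section \<open>Monomials and polynomials in infinitely many variables\<close>

lemma countable_poly_mapping: "countable (UNIV :: ('a::countable \<Rightarrow>\<^sub>0 'b::{countable,zero}) set)"
proof -
  \<comment> \<open>The graph over the support: a finite set that determines the function.\<close>
  define g :: "('a \<Rightarrow>\<^sub>0 'b) \<Rightarrow> ('a \<times> 'b) set"
    where "g f = (\<lambda>i. (i, Poly_Mapping.lookup f i)) ` Poly_Mapping.keys f" for f
  have "Poly_Mapping.lookup f i = Poly_Mapping.lookup h i" if "g f = g h" for f h i
  proof -
    have "(i, x) \<in> g f \<longleftrightarrow> x = Poly_Mapping.lookup f i \<and> x \<noteq> 0" for f x
      by (auto simp: g_def in_keys_iff)
    then show ?thesis
      using that by metis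
  qed
  then have "inj g"
    by (intro injI poly_mapping_eqI)
  moreover have "range g \<subseteq> Collect finite"
    by (auto simp: g_def)
  ultimately show ?thesis
    by (meson countable_Collect_finite countable_image_inj_on countable_subset)
qed

lemma poly_mapping_eq_sum_single:
  fixes f :: "'m \<Rightarrow>\<^sub>0 'k::comm_monoid_add"
  shows "f = (\<Sum>m\<in>Poly_Mapping.keys f. Poly_Mapping.single m (Poly_Mapping.lookup f m))"
  by (rule poly_mapping_eqI) (simp add: lookup_sum lookup_single when_def in_keys_iff)

lemma single_eq_prod_vars:
  fixes m :: "'i \<Rightarrow>\<^sub>0 nat"
  shows "Poly_Mapping.single m (1::'k::comm_semiring_1) =
    (\<Prod>i\<in>Poly_Mapping.keys m. Poly_Mapping.single (Poly_Mapping.single i 1) 1 ^ Poly_Mapping.lookup m i)"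
proof -
  have pow: "(Poly_Mapping.single (Poly_Mapping.single i 1) (1::'k)) ^ n
      = Poly_Mapping.single (Poly_Mapping.single i n) 1" for i :: 'i and n :: nat
    by (induction n) (auto simp: mult_single simp flip: single_add)
  have "(\<Prod>i\<in>I. Poly_Mapping.single (f i) (1::'k)) = Poly_Mapping.single (sum f I) 1"
    for I :: "'i set" and f :: "'i \<Rightarrow> 'i \<Rightarrow>\<^sub>0 nat"
    by (induction I rule: infinite_finite_induct) (auto simp: mult_single)
  \<comment> \<open>The exponent \<open>m\<close> is itself finitely supported, so the expansion
    into singles applies to it as well.\<close>
  then show ?thesis
    by (simp only: pow) (simp flip: poly_mapping_eq_sum_single)
qed

theorem corollary6p5:
  fixes M :: "'k::alg_closed_field inf_mpoly set"
  assumes "uncountable (UNIV :: 'k set)"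
    and "maximalideal M (ring_of_type_algebra :: 'k inf_mpoly ring)"
  shows "zero_locus M \<noteq> {}"
proof -
  define C :: "'k \<Rightarrow> 'k inf_mpoly" where "C = Poly_Mapping.single 0"
  define var :: "nat \<Rightarrow> 'k inf_mpoly" where "var i = Poly_Mapping.single (Poly_Mapping.single i 1) 1" for i
  note M = assms(2)
  have hom: "\<And>x y. C (x + y) = C x + C y" "\<And>x y. C (x * y) = C x * C y" "C 1 = 1"
    by (auto simp: C_def single_add mult_single)
  have C_sum: "C (sum f I) = (\<Sum>i\<in>I. C (f i))" for f :: "(nat \<Rightarrow>\<^sub>0 nat) \<Rightarrow> 'k" and I
    by (induction I rule: infinite_finite_induct) (auto simp: hom hom_zero[OF hom])
  have C_power: "C (x ^ n) = C x ^ n" for x n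
    by (induction n) (auto simp: hom)
  have C_prod: "C (prod f I) = (\<Prod>i\<in>I. C (f i))" for f :: "nat \<Rightarrow> 'k" and I
    by (induction I rule: infinite_finite_induct) (auto simp: hom)
  interpret V: vector_space "\<lambda>a x. C a * x"
    by (rule vector_space_hom[OF hom])
  have expand: "f = (\<Sum>m\<in>Poly_Mapping.keys f. C (Poly_Mapping.lookup f m) * Poly_Mapping.single m 1)"
    for f :: "'k inf_mpoly"
    by (subst (1) poly_mapping_eq_sum_single) (simp add: C_def mult_single)
  \<comment> \<open>The monomials: a countable spanning set over \<open>k\<close>.\<close>
  define B :: "'k inf_mpoly set" where "B = range (\<lambda>m. Poly_Mapping.single m 1)"
  have "countable B"
    unfolding B_def by (intro countable_image countable_poly_mapping)
  moreover have "f \<in> V.span B" for f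
    by (subst expand, intro V.span_sum V.span_scale V.span_base) (simp add: B_def)
  then have "V.span B = UNIV"
    by auto
  ultimately have "\<exists>c. var i - C c \<in> M" for i
    by (intro residue_of_countable_dim[OF hom M assms(1)])
  then obtain a where a: "\<And>i. var i - C (a i) \<in> M"
    by metis
  have monom: "Poly_Mapping.single m 1 - C (eval_monom a m) \<in> M" for m
    unfolding eval_monom_def C_prod C_power
    by (subst single_eq_prod_vars, fold var_def)
      (intro maximal_cong_prod[OF M] maximal_cong_power[OF M] a)
  \<comment> \<open>Modulo \<open>M\<close>, every polynomial is congruent to its value at
    \<open>a\<close>, by linearity from the monomials.\<close>
  have eval: "f - C (eval_inf_mpoly a f) \<in> M" for f
  proof -
    have "(\<Sum>m\<in>Poly_Mapping.keys f. C (Poly_Mapping.lookup f m) *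
        (Poly_Mapping.single m 1 - C (eval_monom a m))) \<in> M"
      by (intro maximal_sum[OF M] maximal_mult[OF M] monom)
    then show ?thesis
      by (simp add: right_diff_distrib sum_subtractf eval_inf_mpoly_def C_sum hom flip: expand)
  qed
  have "eval_inf_mpoly a f = 0" if "f \<in> M" for f
  proof (rule ccontr)
    assume "eval_inf_mpoly a f \<noteq> 0"
    \<comment> \<open>For \<open>f\<close> in \<open>M\<close> the constant \<open>f(a)\<close> lies
      in \<open>M\<close> too, while a nonzero constant is a unit.\<close>
    moreover have "C (eval_inf_mpoly a f) \<in> M"
      using maximal_diff[OF M that eval[of f]] by simp
    ultimately show False
      using hom_notin_maximal[OF hom M] by blast
  qed
  then show ?thesis
    by (auto simp: zero_locus_def)
qed

end
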